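(* Let $n\ge 1$ be an integer. The Jacobi sequence of $\dfrac{e^{2/n}+1}{e^{2/n}-1}$ (where $e$ is Euler's number) is purely periodic, and its smallest period length is $24$ if $n\equiv 1,3\pmod 4$, $8$ if $n\equiv 2\pmod 4$, and $2$ if $n\equiv 0\pmod 4$.
   Context: For $x\in\mathbb{R}\setminus\mathbb{Q}$ with regular continued fraction expansion $x=[a_0,a_1,a_2,\ldots]$, the convergents $s_k/t_k$ are defined by $s_{-1}=1$, $s_0=a_0$, $s_k=a_ks_{k-1}+s_{k-2}$ and $t_{-1}=0$, $t_0=1$, $t_k=a_kt_{k-1}+t_{k-2}$ for $k\ge1$. For an odd natural number $n$ and an integer $m$ coprime to $n$, $\left(\frac{m}{n}\right)$ is the usual Jacobi symbol (equal to $1$ if $n=1$); if $n$ is even and $\gcd(m,n)=1$, one sets $\left(\frac{m}{n}\right)=*$, a fixed symbol different from $\pm1$. The Jacobi sequence of $x$ is $c_k=\left(\frac{s_k}{t_k}\right)$, $k\ge 0$. It is purely periodic with period length $L\ge1$ if $c_{k+L}=c_k$ for all $k\ge0$; the smallest period length is the least such $L$. *)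

theory Defs
  imports Complex_Main "HOL-Number_Theory.Number_Theory"
begin

fun cf_rem :: "real \<Rightarrow> nat \<Rightarrow> real" where
  "cf_rem x 0 = x"
| "cf_rem x (Suc k) = 1 / (cf_rem x k - of_int \<lfloor>cf_rem x k\<rfloor>)"

definition cf :: "real \<Rightarrow> nat \<Rightarrow> int" where
  "cf x k = \<lfloor>cf_rem x k\<rfloor>"

text \<open>Convergents s_k/t_k; index shifted by one: conv_num x k = s_(k-1),
  so conv_num x 0 = s_(-1) = 1, conv_num x 1 = s_0 = a_0.\<close>
fun conv_num :: "real \<Rightarrow> nat \<Rightarrow> int" where
  "conv_num x 0 = 1"
| "conv_num x (Suc 0) = cf x 0"
| "conv_num x (Suc (Suc k)) = cf x (Suc k) * conv_num x (Suc k) + conv_num x k"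

fun conv_den :: "real \<Rightarrow> nat \<Rightarrow> int" where
  "conv_den x 0 = 0"
| "conv_den x (Suc 0) = 1"
| "conv_den x (Suc (Suc k)) = cf x (Suc k) * conv_den x (Suc k) + conv_den x k"

definition s :: "real \<Rightarrow> nat \<Rightarrow> int" where "s x k = conv_num x (Suc k)"
definition t :: "real \<Rightarrow> nat \<Rightarrow> int" where "t x k = conv_den x (Suc k)"

definition Jacobi :: "int \<Rightarrow> int \<Rightarrow> int" where
  "Jacobi m n = (\<Prod>p\<in>prime_factors n. Legendre m p ^ multiplicity p n)"

text \<open>Extended symbol: Some (Jacobi symbol) if n odd, None (the symbol *) if n even.\<close>
definition jac_sym :: "int \<Rightarrow> int \<Rightarrow> int option" where
  "jac_sym m n = (if even n then None else Some (Jacobi m n))"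

definition jacobi_seq :: "real \<Rightarrow> nat \<Rightarrow> int option" where
  "jacobi_seq x k = jac_sym (s x k) (t x k)"

definition has_period :: "(nat \<Rightarrow> 'a) \<Rightarrow> nat \<Rightarrow> bool" where
  "has_period c L \<longleftrightarrow> L \<ge> 1 \<and> (\<forall>k. c (k + L) = c k)"

definition purely_periodic :: "(nat \<Rightarrow> 'a) \<Rightarrow> bool" where
  "purely_periodic c \<longleftrightarrow> (\<exists>L. has_period c L)"

definition smallest_period :: "(nat \<Rightarrow> 'a) \<Rightarrow> nat" where
  "smallest_period c = (LEAST L. has_period c L)"

end

theory Submission
  imports Defs
begin

text \<open>
  By Lambert, $\coth(1/n) = [n, 3n, 5n, \ldots]$, so modulo 4 the partial quotients depend only on
  the parity of the index and on $n$ modulo 4. The determinant identity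
  $s_k t_{k-1} \equiv \pm 1 \pmod{t_k}$ reduces $\left(\frac{s_k}{t_k}\right)$ to
  $\left(\frac{t_{k-1}}{t_k}\right)$. When two consecutive denominators $t_{k-1}, t_k$ are replaced
  by $t_k, t_{k+1}$, this symbol (inverted if its lower entry is even) changes, by reciprocity, by a
  sign depending only on $t_{k-1}$, $t_k$ and the partial quotient modulo 4. The Jacobi sequence is
  therefore the output of a finite automaton, which is run for each residue of $n$ modulo 4.
\<close>

section \<open>The Jacobi symbol\<close>

lemma Legendre_values: "Legendre a p \<in> {-1, 0, 1}"
  by (simp add: Legendre_def)

lemma Legendre_cong: "[a = b] (mod p) \<Longrightarrow> Legendre a p = Legendre b p"
  by (simp add: Legendre_def QuadRes_def cong_def)

text \<open>Distinct elements of {-1, 0, 1} differ by at most 2, which is less than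
  \<open>p\<close>. This turns the congruences of Euler's criterion into equalities.\<close>

lemma Legendre_eq_of_cong:
  assumes "[x = y] (mod p)" "x \<in> {-1, 0, 1}" "y \<in> {-1, 0, 1}" "(p::int) > 2"
  shows "x = y"
proof -
  have "p dvd x - y" using assms(1) by (simp add: cong_iff_dvd_diff)
  moreover have "\<bar>x - y\<bar> < p" using assms(2-4) by auto
  ultimately show ?thesis using zdvd_imp_le[of p "\<bar>x - y\<bar>"] by auto
qed

lemma Legendre_euler:
  assumes "prime p" "odd (p::int)"
  shows "p > 2" "[Legendre a p = a ^ ((nat p - 1) div 2)] (mod p)"
proof -
  show p2: "p > 2" using assms prime_ge_2_int[of p] by (cases "p = 2") auto
  have "prime (nat p)" "2 < nat p" using assms p2 by auto
  from euler_criterion[OF this, of a] show "[Legendre a p = a ^ ((nat p - 1) div 2)] (mod p)"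
    using p2 by simp
qed

lemma Legendre_mult:
  assumes "prime p" "odd (p::int)"
  shows "Legendre (a * b) p = Legendre a p * Legendre b p"
proof (rule Legendre_eq_of_cong)
  have "[Legendre a p * Legendre b p = (a * b) ^ ((nat p - 1) div 2)] (mod p)"
    unfolding power_mult_distrib by (intro cong_mult Legendre_euler assms)
  with Legendre_euler(2)[OF assms, of "a * b"]
  show "[Legendre (a * b) p = Legendre a p * Legendre b p] (mod p)"
    by (metis cong_sym cong_trans)
  show "Legendre a p * Legendre b p \<in> {-1, 0, 1}"
    using Legendre_values[of a p] Legendre_values[of b p] by auto
qed (use Legendre_values Legendre_euler(1)[OF assms] in simp_all)

lemma Legendre_square:
  assumes "prime p" "coprime a p"
  shows "Legendre a p ^ 2 = 1"
proof -
  have "\<not> [a = 0] (mod p)"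
    using assms by (metis cong_0_iff coprime_common_divisor dvd_refl not_prime_unit)
  then show ?thesis by (simp add: Legendre_def)
qed

section \<open>Multiplicativity of the Jacobi symbol in both entries\<close>

lemma Jacobi_1_right [simp]: "Jacobi m 1 = 1"
  by (simp add: Jacobi_def)

lemma Jacobi_prime: "prime p \<Longrightarrow> Jacobi m p = Legendre m p"
  using multiplicity_self[of p] not_prime_unit[of p]
  by (auto simp: Jacobi_def prime_factorization_prime)

lemma Jacobi_mult_right:
  assumes "n \<noteq> 0" "n' \<noteq> 0"
  shows "Jacobi m (n * n') = Jacobi m n * Jacobi m n'"
proof -
  let ?S = "prime_factors n \<union> prime_factors n'"
  \<comment> \<open>Primes not dividing \<open>k\<close> have exponent 0, so all three products can
    run over one index set.\<close>
  have ext: "Jacobi m k = (\<Prod>p\<in>?S. Legendre m p ^ multiplicity p k)"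
    if "prime_factors k \<subseteq> ?S" "k \<noteq> 0" for k
    unfolding Jacobi_def
  proof (rule prod.mono_neutral_left)
    show "\<forall>i\<in>?S - prime_factors k. Legendre m i ^ multiplicity i k = 1"
      using that(2) by (auto simp: in_prime_factors_iff not_dvd_imp_multiplicity_0)
  qed (use that in auto)
  have "Jacobi m (n * n') = (\<Prod>p\<in>?S. Legendre m p ^ multiplicity p (n * n'))"
    using assms by (intro ext) (auto simp: prime_factors_product)
  also have "\<dots> = (\<Prod>p\<in>?S. Legendre m p ^ multiplicity p n * Legendre m p ^ multiplicity p n')"
    using assms
    by (intro prod.cong) (auto simp: prime_elem_multiplicity_mult_distrib in_prime_factors_iff power_add)
  also have "\<dots> = Jacobi m n * Jacobi m n'"
    using assms by (simp add: prod.distrib ext)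
  finally show ?thesis .
qed

text \<open>Peels off one odd prime at a time, which reduces multiplicative facts about Jacobi
  symbols to Legendre symbols.\<close>

lemma odd_pos_induct [consumes 2, case_names one factor]:
  fixes n :: int
  assumes "odd n" "n > 0"
    and "P 1"
    and step: "\<And>p n. prime p \<Longrightarrow> odd p \<Longrightarrow> odd n \<Longrightarrow> n > 0 \<Longrightarrow> P n \<Longrightarrow> P (p * n)"
  shows "P n"
proof -
  have "odd n \<longrightarrow> n > 0 \<longrightarrow> P n"
  proof (induction n rule: prime_divisors_induct)
    case (unit x)
    then show ?case using assms(3) by (auto simp: zdvd1_eq)
  next
    case (factor p x)
    then show ?case using step[of p x] by (auto simp: zero_less_mult_iff dest: prime_gt_0_int)
  qed auto
  then show ?thesis using assms by simp
qed

lemma Jacobi_cong: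
  assumes "[a = b] (mod n)"
  shows "Jacobi a n = Jacobi b n"
  unfolding Jacobi_def
proof (rule prod.cong)
  fix p assume "p \<in> prime_factors n"
  then have "[a = b] (mod p)"
    using assms by (meson cong_dvd_modulus in_prime_factors_imp_dvd)
  then show "Legendre a p ^ multiplicity p n = Legendre b p ^ multiplicity p n"
    by (simp add: Legendre_cong)
qed simp

lemma Jacobi_mult_left:
  assumes "odd n" "n > 0"
  shows "Jacobi (a * b) n = Jacobi a n * Jacobi b n"
  using assms
  by (induction n rule: odd_pos_induct)
    (auto simp: Jacobi_mult_right Jacobi_prime Legendre_mult)

lemma Jacobi_square:
  assumes "odd n" "n > 0" "coprime a n"
  shows "Jacobi a n ^ 2 = 1"
  using assms
  by (induction n rule: odd_pos_induct)
    (auto simp: Jacobi_mult_right Jacobi_prime Legendre_square power_mult_distrib)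

lemma Jacobi_1_left [simp]: "Jacobi 1 n = 1"
proof -
  have "Legendre 1 p = 1" if "prime p" for p :: int
  proof -
    have "\<not> [1 = 0] (mod p)" using that by (auto simp: cong_0_iff)
    moreover have "QuadRes p 1" unfolding QuadRes_def by (rule exI[of _ 1]) simp
    ultimately show ?thesis by (simp add: Legendre_def)
  qed
  then show ?thesis by (simp add: Jacobi_def in_prime_factors_iff)
qed

section \<open>The symbol of -1 and quadratic reciprocity, expressed by residues modulo 4\<close>

definition chi4 :: "int \<Rightarrow> int" where
  "chi4 n = (if n mod 4 = 3 then -1 else 1)"

lemma odd_mod_4: "odd (n::int) \<Longrightarrow> n mod 4 = 1 \<or> n mod 4 = 3"
  by presburger

lemma chi4_mult:
  assumes "odd a" "odd b"
  shows "chi4 (a * b) = chi4 a * chi4 b"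
  using odd_mod_4[OF assms(1)] odd_mod_4[OF assms(2)] mod_mult_eq[of a 4 b]
  by (auto simp: chi4_def)

lemma neg_one_power_chi4:
  assumes "odd n" "n > 0"
  shows "(-1) ^ ((nat n - 1) div 2) = chi4 n"
proof -
  have "int ((nat n - 1) div 2) = (n - 1) div 2"
    using assms by (simp add: zdiv_int of_nat_diff)
  moreover have "even ((n - 1) div 2) \<longleftrightarrow> n mod 4 \<noteq> 3"
    using assms(1) by presburger
  ultimately have "even ((nat n - 1) div 2) \<longleftrightarrow> n mod 4 \<noteq> 3"
    by (metis even_of_nat)
  then show ?thesis by (auto simp: chi4_def)
qed

lemma Jacobi_neg_1:
  assumes "odd n" "n > 0"
  shows "Jacobi (-1) n = chi4 n"
  using assms
proof (induction n rule: odd_pos_induct)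
  case one
  show ?case by (simp add: chi4_def)
next
  case (factor p n)
  have p: "p > 2" by (rule Legendre_euler(1)) fact+
  have "Legendre (-1) p = chi4 p"
  proof (rule Legendre_eq_of_cong[OF _ Legendre_values _ p])
    show "[Legendre (-1) p = chi4 p] (mod p)"
      using Legendre_euler(2)[OF factor(1,2), of "-1"] neg_one_power_chi4[OF factor(2)] p by simp
  qed (simp add: chi4_def)
  with factor p show ?case by (simp add: Jacobi_mult_right Jacobi_prime chi4_mult)
qed

text \<open>For odd entries, the sign (-1)^((m-1)/2 * (n-1)/2) of the reciprocity law. An even entry
  gives 1, the value that \<open>pair_sign\<close> needs there.\<close>

definition rec_sign :: "int \<Rightarrow> int \<Rightarrow> int" where
  "rec_sign m n = (if m mod 4 = 3 \<and> n mod 4 = 3 then -1 else 1)"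

lemma rec_sign_commute: "rec_sign m n = rec_sign n m"
  by (simp add: rec_sign_def)

lemma rec_sign_mult:
  assumes "odd a" "odd b"
  shows "rec_sign m (a * b) = rec_sign m a * rec_sign m b"
  using chi4_mult[OF assms] by (auto simp: rec_sign_def chi4_def split: if_splits)

text \<open>Reciprocity is extended from primes in two rounds: here \<open>n\<close> is factored, in
  \<open>Jacobi_reciprocity\<close> the other entry.\<close>

lemma Jacobi_reciprocity_prime:
  assumes "prime p" "odd (p::int)" "odd n" "n > 0" "coprime p n"
  shows "Jacobi p n * Jacobi n p = rec_sign p n"
  using assms(3-5)
proof (induction n rule: odd_pos_induct)
  case one
  show ?case by (simp add: rec_sign_def)
next
  case (factor q n)
  have pq: "p > 2" "q > 2" using Legendre_euler(1) factor assms by auto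
  have "p \<noteq> q" using factor(6) pq by auto
  then have "Legendre p q * Legendre q p = (-1) ^ nat ((p - 1) div 2 * ((q - 1) div 2))"
    using Quadratic_Reciprocity_int[of p q] pq assms factor by (simp add: mult.commute)
  also have "\<dots> = rec_sign p q"
  proof -
    have e: "even (nat ((p - 1) div 2 * ((q - 1) div 2))) \<longleftrightarrow>
        even ((p - 1) div 2) \<or> even ((q - 1) div 2)"
      using pq by (subst even_nat_iff) auto
    have "even ((p - 1) div 2) \<longleftrightarrow> p mod 4 \<noteq> 3" "even ((q - 1) div 2) \<longleftrightarrow> q mod 4 \<noteq> 3"
      using assms(2) factor(2) by presburger+
    with e show ?thesis by (auto simp: rec_sign_def uminus_power_if)
  qed
  finally have "Legendre p q * Legendre q p = rec_sign p q" .
  moreover have "Jacobi p n * Jacobi n p = rec_sign p n" using factor by simp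
  ultimately show ?case
    using factor assms pq
    by (simp add: Jacobi_mult_right Jacobi_mult_left Jacobi_prime rec_sign_mult Legendre_mult
        flip: \<open>Legendre p q * Legendre q p = rec_sign p q\<close> \<open>Jacobi p n * Jacobi n p = rec_sign p n\<close>)
qed

lemma Jacobi_reciprocity:
  assumes "odd m" "m > 0" "odd n" "n > 0" "coprime m n"
  shows "Jacobi m n = rec_sign m n * Jacobi n m"
proof -
  have "Jacobi m n * Jacobi n m = rec_sign m n"
    using assms(1,2,5)
  proof (induction m rule: odd_pos_induct)
    case one
    show ?case by (simp add: rec_sign_def)
  next
    case (factor p m)
    have "Jacobi p n * Jacobi n p = rec_sign p n"
      using factor assms by (intro Jacobi_reciprocity_prime) auto
    moreover have "Jacobi m n * Jacobi n m = rec_sign m n" using factor by simp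
    moreover have "Jacobi (p * m) n * Jacobi n (p * m)
        = (Jacobi p n * Jacobi n p) * (Jacobi m n * Jacobi n m)"
      using factor assms by (auto simp: Jacobi_mult_right Jacobi_mult_left)
    ultimately show ?case
      using factor by (simp add: rec_sign_commute[of _ n] rec_sign_mult)
  qed
  \<comment> \<open>By coprimality \<open>Jacobi n m\<close> squares to 1, so multiplying by it
    moves it to the other side.\<close>
  then have "Jacobi m n * Jacobi n m ^ 2 = rec_sign m n * Jacobi n m"
    by (simp add: power2_eq_square)
  moreover have "Jacobi n m ^ 2 = 1"
    using assms by (intro Jacobi_square) (auto simp: coprime_commute)
  ultimately show ?thesis by simp
qed

text \<open>
  Passing through the odd number \<open>e + d\<close> needs reciprocity only, hence no formula for the
  symbol \<open>Jacobi 2 d\<close> and no information modulo 8.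
\<close>
lemma Jacobi_even_add:
  assumes "even e" "e > 0" "odd d" "d > 0" "coprime e d"
  shows "Jacobi e (e + d) = (if d mod 4 = 1 \<and> e mod 4 = 2 then -1 else 1) * Jacobi e d"
proof -
  have cop: "coprime (e + d) d" using assms(5) by (simp add: coprime_iff_gcd_eq_1)
  have "Jacobi e d = Jacobi (e + d) d"
    by (rule Jacobi_cong) (simp add: cong_def)
  also have "\<dots> = rec_sign (e + d) d * Jacobi d (e + d)"
    using assms cop by (intro Jacobi_reciprocity) auto
  also have "Jacobi d (e + d) = Jacobi (-1 * e) (e + d)"
    by (rule Jacobi_cong) (simp add: cong_iff_dvd_diff add.commute)
  also have "\<dots> = chi4 (e + d) * Jacobi e (e + d)"
    using Jacobi_mult_left[of "e + d" "-1" e] Jacobi_neg_1[of "e + d"] assms by simp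
  finally have *: "Jacobi e d = rec_sign (e + d) d * chi4 (e + d) * Jacobi e (e + d)" by simp
  have "rec_sign (e + d) d * chi4 (e + d) = (if d mod 4 = 1 \<and> e mod 4 = 2 then -1 else 1)"
  proof -
    have "(e + d) mod 4 = 3 \<longleftrightarrow> (d mod 4 = 1 \<and> e mod 4 = 2) \<or> (d mod 4 = 3 \<and> e mod 4 = 0)"
      using assms(1,3) by presburger
    moreover have "e mod 4 = 0 \<or> e mod 4 = 2" using assms(1) by presburger
    ultimately show ?thesis by (auto simp: rec_sign_def chi4_def)
  qed
  with * show ?thesis by simp
qed

text \<open>The product of the signs from \<open>a\<close> successive uses of
  \<open>Jacobi_even_add\<close>. If \<open>e\<close> is 2 modulo 4, adding \<open>e\<close>
  switches between the residues 1 and 3, so every second use gives -1 and the product has period 4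
  in \<open>a\<close>.\<close>

definition even_sign :: "int \<Rightarrow> int \<Rightarrow> int \<Rightarrow> int" where
  "even_sign a e d = (if e mod 4 = 2 \<and>
     (d mod 4 = 1 \<and> a mod 4 \<in> {1, 2} \<or> d mod 4 = 3 \<and> a mod 4 \<in> {2, 3}) then -1 else 1)"

lemma Jacobi_even_add_mult:
  assumes "even e" "e > 0" "odd d" "d > 0" "coprime e d"
  shows "Jacobi e (int a * e + d) = even_sign (int a) e d * Jacobi e d"
proof (induction a)
  case 0
  show ?case by (simp add: even_sign_def)
next
  case (Suc a)
  let ?d = "int a * e + d"
  have cop: "coprime e ?d"
    using assms(5) by (metis coprime_iff_gcd_eq_1 gcd_add_mult mult.commute add.commute)
  have "Jacobi e (int (Suc a) * e + d) = Jacobi e (e + ?d)" by (simp add: algebra_simps)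
  also have "\<dots> = (if ?d mod 4 = 1 \<and> e mod 4 = 2 then -1 else 1) * Jacobi e ?d"
    using assms cop by (intro Jacobi_even_add) (auto intro: add_nonneg_pos)
  also have "\<dots> = (if ?d mod 4 = 1 \<and> e mod 4 = 2 then -1 else 1) * even_sign (int a) e d * Jacobi e d"
    using Suc by simp
  also have "(if ?d mod 4 = 1 \<and> e mod 4 = 2 then -1 else 1) * even_sign (int a) e d
      = even_sign (int (Suc a)) e d"
  proof -
    have d: "?d mod 4 = ((int a mod 4) * (e mod 4) + d mod 4) mod 4"
      by (intro mod_add_cong mod_mult_cong) simp_all
    have s: "int (Suc a) mod 4 = (int a mod 4 + 1) mod 4" by (simp add: mod_simps add.commute)
    have a4: "int a mod 4 \<in> {0, 1, 2, 3}" by auto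
    have e4: "e mod 4 = 0 \<or> e mod 4 = 2" using assms(1) by presburger
    \<comment> \<open>Only 16 triples of residues occur; with plain variables each case is a
      numerical evaluation.\<close>
    have residues: "(if (A * E + D) mod 4 = 1 \<and> E = 2 then -1 else 1) *
        (if E = 2 \<and> (D = 1 \<and> A \<in> {1, 2} \<or> D = 3 \<and> A \<in> {2, 3}) then -1 else 1) =
        (if E = 2 \<and> (D = 1 \<and> (A + 1) mod 4 \<in> {1, 2} \<or> D = 3 \<and> (A + 1) mod 4 \<in> {2, 3})
         then -1 else 1 :: int)"
      if "A \<in> {0, 1, 2, 3}" "D = 1 \<or> D = 3" "E = 0 \<or> E = 2" for A D E :: int
      using that by (elim insertE emptyE disjE) simp_all
    show ?thesis
      unfolding even_sign_def d s by (rule residues[OF a4 odd_mod_4[OF assms(3)] e4])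
  qed
  finally show ?case .
qed

section \<open>The continued fraction of $\coth(1/n)$\<close>

text \<open>
  The coefficient is $1 / (2^j\, j!\, (2j+2k-1)!!)$; up to a power of \<open>y\<close>, \<open>lambert k y\<close> is a
  modified spherical Bessel function.
\<close>
definition lambert_coeff :: "nat \<Rightarrow> nat \<Rightarrow> real" where
  "lambert_coeff k j = 2 ^ k * fact (j + k) / (fact j * fact (2 * j + 2 * k))"

definition lambert :: "nat \<Rightarrow> real \<Rightarrow> real" where
  "lambert k y = (\<Sum>j. lambert_coeff k j * y ^ (2 * j))"

lemma lambert_coeff_pos: "lambert_coeff k j > 0"
  by (simp add: lambert_coeff_def)

lemma lambert_coeff_Suc: "lambert_coeff k j = (2 * j + 2 * k + 1) * lambert_coeff (Suc k) j"
proof -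
  have "fact (2 * j + 2 * Suc k) =
      (2 * real j + 2 * k + 2) * ((2 * real j + 2 * k + 1) * fact (2 * j + 2 * k))"
    by (simp add: algebra_simps)
  moreover have "2 * real j + 2 * k + 2 \<noteq> 0" "2 * real j + 2 * k + 1 \<noteq> 0"
    by (simp_all add: add_nonneg_eq_0_iff)
  ultimately show ?thesis
    unfolding lambert_coeff_def by (simp add: divide_simps)
qed

lemma lambert_coeff_shift: "lambert_coeff (Suc (Suc k)) j = 2 * Suc j * lambert_coeff (Suc k) (Suc j)"
  unfolding lambert_coeff_def by (simp add: divide_simps) 

text \<open>All terms are multiples of \<open>lambert_coeff (Suc k) (Suc j)\<close>. The shift from
  \<open>Suc j\<close> to \<open>j\<close> becomes the factor \<open>y\<^sup>2\<close> in
  \<open>lambert_recurrence\<close>.\<close>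

lemma lambert_coeff_recurrence:
  "lambert_coeff k (Suc j) - (2 * k + 1) * lambert_coeff (Suc k) (Suc j) = lambert_coeff (Suc (Suc k)) j"
  unfolding lambert_coeff_shift lambert_coeff_Suc[of k] by (simp add: algebra_simps)

lemma lambert_coeff_recurrence_0: "lambert_coeff k 0 = (2 * k + 1) * lambert_coeff (Suc k) 0"
  by (simp add: lambert_coeff_Suc[of k])

lemma lambert_coeff_0: "lambert_coeff 0 j = 1 / fact (2 * j)"
  by (simp add: lambert_coeff_def)

lemma lambert_coeff_1: "lambert_coeff (Suc 0) j = 1 / fact (2 * j + 1)"
  using lambert_coeff_Suc[of 0 j] by (simp add: lambert_coeff_0 divide_simps) (simp add: algebra_simps)

section \<open>The Lambert series: cosh and sinh, convergence, three-term recurrence\<close>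

lemma lambert_0_sums: "(\<lambda>j. lambert_coeff 0 j * y ^ (2 * j)) sums cosh y"
proof -
  have "(\<lambda>n. if even n then y ^ n /\<^sub>R fact n else 0) sums cosh y" by (rule cosh_converges)
  then have "(\<lambda>j. (\<lambda>n. if even n then y ^ n /\<^sub>R fact n else 0) (2 * j)) sums cosh y"
    by (subst sums_mono_reindex) (auto simp: strict_mono_def elim!: evenE)
  then show ?thesis by (simp add: lambert_coeff_0 field_simps)
qed

lemma lambert_1_sums: "(\<lambda>j. y * (lambert_coeff (Suc 0) j * y ^ (2 * j))) sums sinh y"
proof -
  have "(\<lambda>n. if even n then 0 else y ^ n /\<^sub>R fact n) sums sinh y" by (rule sinh_converges)
  then have "(\<lambda>j. (\<lambda>n. if even n then 0 else y ^ n /\<^sub>R fact n) (2 * j + 1)) sums sinh y"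
    by (subst sums_mono_reindex) (auto simp: strict_mono_def elim!: oddE)
  then show ?thesis by (simp add: lambert_coeff_1 field_simps)
qed

text \<open>The case \<open>k = 0\<close> is the cosh series; the coefficients do not grow with
  \<open>k\<close>, so comparison does the rest.\<close>

lemma lambert_summable: "summable (\<lambda>j. lambert_coeff k j * y ^ (2 * j))"
proof (induction k)
  case 0
  show ?case using lambert_0_sums sums_summable by blast
next
  case (Suc k)
  show ?case
  proof (rule summable_comparison_test'[OF Suc])
    fix j :: nat
    have "lambert_coeff (Suc k) j \<le> lambert_coeff k j"
      using lambert_coeff_pos[of "Suc k" j] unfolding lambert_coeff_Suc[of k j]
      by (simp add: mult_le_cancel_right1)
    then show "norm (lambert_coeff (Suc k) j * y ^ (2 * j)) \<le> lambert_coeff k j * y ^ (2 * j)"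
      using lambert_coeff_pos[of "Suc k" j] by (simp add: abs_mult mult_right_mono power_mult)
  qed
qed

lemma lambert_pos: "lambert k y > 0"
  unfolding lambert_def
proof (rule suminf_pos2[OF lambert_summable, where i = 0])
  show "0 \<le> lambert_coeff k j * y ^ (2 * j)" for j
    using lambert_coeff_pos[of k j] by (simp add: power_mult)
qed (simp add: lambert_coeff_pos)

text \<open>Compares coefficients. Division by \<open>lambert (Suc k) y\<close> turns it into one
  step of a continued fraction.\<close>

lemma lambert_recurrence:
  "lambert k y = (2 * k + 1) * lambert (Suc k) y + y\<^sup>2 * lambert (Suc (Suc k)) y"
proof -
  let ?f = "\<lambda>k j. lambert_coeff k j * y ^ (2 * j)"
  have split: "lambert k y = lambert_coeff k 0 + (\<Sum>j. ?f k (Suc j))" for k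
    unfolding lambert_def using suminf_split_head[OF lambert_summable[of k y]] by simp
  have sm: "summable (\<lambda>j. ?f k (Suc j))" for k
    using lambert_summable[of k y] by (subst summable_Suc_iff)
  have "(\<Sum>j. ?f k (Suc j)) - (2 * k + 1) * (\<Sum>j. ?f (Suc k) (Suc j))
      = (\<Sum>j. ?f k (Suc j) - (2 * k + 1) * ?f (Suc k) (Suc j))"
    using suminf_diff[OF sm[of k] summable_mult[OF sm[of "Suc k"], of "real (2 * k + 1)"]]
      suminf_mult[OF sm[of "Suc k"], of "real (2 * k + 1)"] by metis
  also have "\<dots> = (\<Sum>j. y\<^sup>2 * ?f (Suc (Suc k)) j)"
    unfolding lambert_coeff_recurrence[symmetric]
    by (intro suminf_cong) (simp add: algebra_simps power2_eq_square)
  also have "\<dots> = y\<^sup>2 * lambert (Suc (Suc k)) y"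
    unfolding lambert_def by (rule suminf_mult[OF lambert_summable])
  finally show ?thesis
    unfolding split[of k] split[of "Suc k"] using lambert_coeff_recurrence_0[of k]
    by (simp add: algebra_simps)
qed

lemma lambert_Suc_less:
  assumes "y \<noteq> 0"
  shows "lambert (Suc k) y < lambert k y"
proof -
  have "0 < y\<^sup>2 * lambert (Suc (Suc k)) y" using assms lambert_pos by simp
  moreover have "lambert (Suc k) y \<le> (2 * k + 1) * lambert (Suc k) y"
    using lambert_pos[of "Suc k" y] by (simp add: mult_le_cancel_right1)
  ultimately show ?thesis using lambert_recurrence[of k y] by (simp add: add.commute)
qed

lemma coth_eq_lambert:
  assumes "y > 0"
  shows "(exp (2 * y) + 1) / (exp (2 * y) - 1) = lambert 0 y / (y * lambert 1 y)"
proof -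
  have c: "lambert 0 y = cosh y"
    unfolding lambert_def using lambert_0_sums sums_unique by metis
  have s: "y * lambert 1 y = sinh y"
    unfolding lambert_def
    using sums_unique[OF lambert_1_sums[of y]] suminf_mult[OF lambert_summable[of "Suc 0" y]] by simp
  have "exp (2 * y) = exp y * exp y" by (simp flip: exp_add)
  then have "(exp (2 * y) + 1) / (exp (2 * y) - 1) = (exp y * (2 * cosh y)) / (exp y * (2 * sinh y))"
    by (simp add: cosh_def sinh_def algebra_simps flip: exp_add)
  then show ?thesis unfolding c s by simp
qed

lemma cf_coth:
  fixes n :: nat
  assumes "n \<ge> 1"
  defines "x \<equiv> (exp (2 / real n) + 1) / (exp (2 / real n) - 1)"
  shows "cf x k = (2 * int k + 1) * int n"
proof -
  define y where "y = 1 / real n"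
  have y: "y > 0" using assms by (simp add: y_def)
  \<comment> \<open>These are the complete quotients of \<open>x\<close>: as
    \<open>n * y\<^sup>2 = 1 / n\<close>, the recurrence becomes
    \<open>r k = (2 * k + 1) * n + 1 / r (Suc k)\<close>.\<close>
  define r where "r = (\<lambda>k. real n * lambert k y / lambert (Suc k) y)"
  have r_Suc: "r k = real ((2 * k + 1) * n) + 1 / r (Suc k)" for k
    using lambert_pos[of "Suc k" y] lambert_pos[of "Suc (Suc k)" y] assms(1)
    unfolding r_def lambert_recurrence[of k] y_def
    by (simp add: field_simps power2_eq_square)
  have r_gt: "r k > 1" for k
  proof -
    have "1 < lambert k y / lambert (Suc k) y"
      using lambert_Suc_less[of y k] lambert_pos[of "Suc k" y] y by simp
    also have "\<dots> \<le> real n * (lambert k y / lambert (Suc k) y)"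
      using assms(1) lambert_pos[of "Suc k" y] lambert_pos[of k y]
      by (subst mult_le_cancel_right1) (auto simp: divide_less_0_iff)
    finally show ?thesis by (simp add: r_def)
  qed
  \<comment> \<open>\<open>r (Suc k) > 1\<close> puts the fractional term
    \<open>1 / r (Suc k)\<close> strictly between 0 and 1.\<close>
  have floor_r: "\<lfloor>r k\<rfloor> = int ((2 * k + 1) * n)" for k
    unfolding r_Suc[of k] using r_gt[of "Suc k"] by (intro floor_unique) (auto simp: field_simps)
  have rem: "cf_rem x k = r k" for k
  proof (induction k)
    case 0
    have "x = lambert 0 y / (y * lambert 1 y)"
      using coth_eq_lambert[OF y] by (simp add: x_def y_def)
    then show ?case by (simp add: r_def y_def)
  next
    case (Suc k)
    have "r k - of_int \<lfloor>r k\<rfloor> = 1 / r (Suc k)"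
      unfolding floor_r using r_Suc[of k] by simp
    then show ?case by (simp add: Suc)
  qed
  show ?thesis unfolding cf_def rem floor_r by (simp add: algebra_simps)
qed

section \<open>The Jacobi sequence modulo 4\<close>

text \<open>Each recurrence step flips the sign of the determinant. By the index shift
  \<open>Suc k\<close> belongs to \<open>s x k\<close>, so even \<open>k\<close> gives -1.\<close>

lemma conv_det:
  "conv_num x (Suc k) * conv_den x k - conv_num x k * conv_den x (Suc k) = (-1) ^ Suc k"
  by (induction k) (simp_all add: algebra_simps)

lemma coprime_conv_den: "coprime (conv_den x k) (conv_den x (Suc k))"
proof (rule coprimeI)
  fix d assume "d dvd conv_den x k" "d dvd conv_den x (Suc k)"
  then have "d dvd (-1) ^ Suc k"
    unfolding conv_det[of x k, symmetric] by (intro dvd_diff dvd_mult)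
  then show "is_unit d" by (auto simp: uminus_power_if split: if_splits)
qed

lemma conv_den_pos:
  assumes "\<And>k. cf x k > 0"
  shows "conv_den x k \<ge> 0" "conv_den x (Suc k) > 0"
proof (induction k)
  case (Suc k)
  { case 1 then show ?case using Suc by simp }
  { case 2 then show ?case using Suc assms[of "Suc k"] by (simp add: add_pos_nonneg) }
qed simp_all

text \<open>Coprime \<open>u\<close> and \<open>v\<close> are not both even, so one of the two
  symbols has an odd lower entry. A sign is thus carried along even where the Jacobi sequence is
  \<open>None\<close>.\<close>

definition Jacobi_pair :: "int \<Rightarrow> int \<Rightarrow> int" where
  "Jacobi_pair u v = (if odd v then Jacobi u v else Jacobi v u)"

definition pair_sign :: "int \<Rightarrow> int \<Rightarrow> int \<Rightarrow> int" where
  "pair_sign a u v = (if odd v then rec_sign v (a * v + u) else even_sign a v u)"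

text \<open>This is what makes the automaton finite: the sign can be computed from the stored
  residues.\<close>

lemma pair_sign_mod: "pair_sign (a mod 4) (u mod 4) (v mod 4) = pair_sign a u v"
proof -
  have "((a mod 4) * (v mod 4) + u mod 4) mod 4 = (a * v + u) mod 4"
    by (intro mod_add_cong mod_mult_cong) simp_all
  moreover have "odd (v mod 4) \<longleftrightarrow> odd v" by presburger
  ultimately show ?thesis by (simp add: pair_sign_def rec_sign_def even_sign_def)
qed

text \<open>For odd \<open>v\<close>, the new denominator is congruent to \<open>u\<close> modulo
  \<open>v\<close>; reciprocity is applied first if it is odd, while an even one already stands on
  top. For even \<open>v\<close>, both symbols have \<open>v\<close> on top and
  \<open>Jacobi_even_add_mult\<close> applies.\<close>

lemma Jacobi_pair_step:
  assumes "a > 0" "u \<ge> 0" "v > 0" "coprime u v"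
  shows "Jacobi_pair v (a * v + u) = pair_sign a u v * Jacobi_pair u v"
proof (cases "odd v")
  case True
  have red: "Jacobi (a * v + u) v = Jacobi u v"
    by (rule Jacobi_cong) (simp add: cong_def)
  have w: "a * v + u > 0" using assms by (simp add: add_pos_nonneg)
  have cop: "coprime v (a * v + u)"
    using assms(4) by (metis add.commute coprime_commute coprime_iff_gcd_eq_1 gcd_add_mult)
  show ?thesis
  proof (cases "odd (a * v + u)")
    case odd: True
    have "Jacobi v (a * v + u) = rec_sign v (a * v + u) * Jacobi (a * v + u) v"
      by (rule Jacobi_reciprocity) fact+
    with True odd red show ?thesis by (simp only: Jacobi_pair_def pair_sign_def if_True not_False_eq_True)
  next
    case False
    moreover have "w mod 4 \<noteq> 3" if "even w" for w :: int using that by presburger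
    ultimately have "(a * v + u) mod 4 \<noteq> 3" by blast
    with True False red show ?thesis by (simp add: Jacobi_pair_def pair_sign_def rec_sign_def)
  qed
next
  case False
  then have u: "odd u" using assms(4) by (auto dest: coprime_common_divisor[of u v 2])
  then have "u > 0" using assms(2) by (cases "u = 0") auto
  have "Jacobi v (int (nat a) * v + u) = even_sign (int (nat a)) v u * Jacobi v u"
    using False u assms \<open>u > 0\<close> by (intro Jacobi_even_add_mult) (auto simp: coprime_commute)
  with False u assms(1) show ?thesis by (simp add: Jacobi_pair_def pair_sign_def)
qed

text \<open>By \<open>conv_det\<close>, numerator and previous denominator are inverse modulo the
  denominator up to sign. For even \<open>k\<close> that sign is -1, and its symbol is
  \<open>chi4\<close>.\<close>

lemma Jacobi_conv:
  assumes "odd (conv_den x (Suc k))" "conv_den x (Suc k) > 0"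
  shows "Jacobi (conv_num x (Suc k)) (conv_den x (Suc k)) =
    (if even k then chi4 (conv_den x (Suc k)) else 1) * Jacobi (conv_den x k) (conv_den x (Suc k))"
proof -
  let ?S = "conv_num x (Suc k)" and ?T = "conv_den x (Suc k)" and ?U = "conv_den x k"
  have "Jacobi (?S * ?U) ?T = Jacobi ((-1) ^ Suc k) ?T"
    by (rule Jacobi_cong) (simp add: cong_iff_dvd_diff flip: conv_det[of x k] del: power_Suc)
  then have "Jacobi ?S ?T * Jacobi ?U ?T = (if even k then chi4 ?T else 1)"
    using assms by (simp add: Jacobi_mult_left Jacobi_neg_1 uminus_power_if)
  moreover have "Jacobi ?U ?T ^ 2 = 1"
    using assms coprime_conv_den by (intro Jacobi_square)
  moreover have "Jacobi ?S ?T = (Jacobi ?S ?T * Jacobi ?U ?T) * Jacobi ?U ?T"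
    using \<open>Jacobi ?U ?T ^ 2 = 1\<close> by (simp add: power2_eq_square mult.assoc)
  ultimately show ?thesis by simp
qed

text \<open>
  The state after \<open>k\<close> steps is $(t_{k-1} \bmod 4, t_k \bmod 4)$ together with \<open>Jacobi_pair\<close> of
  $(t_{k-1}, t_k)$. The Boolean is the parity of \<open>k\<close>, and 3 and 1 are the residues of the factor
  $2k + 3$ of the next partial quotient.
\<close>
fun jstep :: "int \<Rightarrow> bool \<Rightarrow> int \<times> int \<times> int \<Rightarrow> int \<times> int \<times> int" where
  "jstep m b (u, v, j) =
    (v, ((if b then 3 else 1) * m * v + u) mod 4, pair_sign ((if b then 3 else 1) * m) u v * j)"

fun jstate :: "int \<Rightarrow> nat \<Rightarrow> int \<times> int \<times> int" where
  "jstate m 0 = (0, 1, 1)"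
| "jstate m (Suc k) = jstep m (even k) (jstate m k)"

text \<open>The factor \<open>chi4 v\<close> at even indices is the one from
  \<open>Jacobi_conv\<close>; it depends only on the stored residue.\<close>

fun jout :: "bool \<Rightarrow> int \<times> int \<times> int \<Rightarrow> int option" where
  "jout b (u, v, j) = (if even v then None else Some ((if b then chi4 v else 1) * j))"

lemma jstate_conv:
  assumes cf: "\<And>k. cf x k = (2 * int k + 1) * int n" and "n \<ge> 1"
  shows "jstate (int n mod 4) k =
    (conv_den x k mod 4, conv_den x (Suc k) mod 4, Jacobi_pair (conv_den x k) (conv_den x (Suc k)))"
proof (induction k)
  case 0
  show ?case by (simp add: Jacobi_pair_def)
next
  case (Suc k)
  have pos: "cf x k > 0" for k using assms by simp
  let ?u = "conv_den x k" and ?v = "conv_den x (Suc k)" and ?a = "cf x (Suc k)"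
  let ?b = "(if even k then 3 else 1) * (int n mod 4)"
  have ab: "?b mod 4 = ?a mod 4"
  proof -
    have "(2 * int (Suc k) + 1) mod 4 = (if even k then 3 else 1)" by presburger
    then show ?thesis unfolding cf by (intro mod_mult_cong) (simp_all split: if_splits)
  qed
  have "(?b * (?v mod 4) + ?u mod 4) mod 4 = (?a * ?v + ?u) mod 4"
    using ab by (intro mod_add_cong mod_mult_cong) simp_all
  \<comment> \<open>\<open>?b\<close> is not reduced modulo 4 and can be as large as 9, so both
    signs are compared through their residues.\<close>
  moreover have "pair_sign ?b (?u mod 4) (?v mod 4) = pair_sign ?a ?u ?v"
    using ab pair_sign_mod[of ?b "?u mod 4" "?v mod 4"] pair_sign_mod[of ?a ?u ?v] by simp
  moreover have "Jacobi_pair ?v (?a * ?v + ?u) = pair_sign ?a ?u ?v * Jacobi_pair ?u ?v"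
    using pos conv_den_pos[OF pos] coprime_conv_den by (intro Jacobi_pair_step)
  ultimately show ?case using Suc by simp
qed

lemma jacobi_seq_eq_jout:
  assumes "\<And>k. cf x k = (2 * int k + 1) * int n" and "n \<ge> 1"
  shows "jacobi_seq x = (\<lambda>k. jout (even k) (jstate (int n mod 4) k))"
proof
  fix k
  have pos: "cf x k > 0" for k using assms by simp
  have "odd (conv_den x (Suc k) mod 4) \<longleftrightarrow> odd (conv_den x (Suc k))" by presburger
  then show "jacobi_seq x k = jout (even k) (jstate (int n mod 4) k)"
    using Jacobi_conv[OF _ conv_den_pos(2)[OF pos], of k]
    by (auto simp: jacobi_seq_def jac_sym_def s_def t_def jstate_conv[OF assms]
        Jacobi_pair_def chi4_def)
qed

text \<open>Once the initial state recurs after an even number of steps, the parity input agrees as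
  well and the run repeats.\<close>

lemma jout_has_period:
  assumes "jstate m p = (0, 1, 1)" "even p" "p \<ge> 1"
  shows "has_period (\<lambda>k. jout (even k) (jstate m k)) p"
proof -
  have "jstate m (k + p) = jstate m k" for k
    using assms by (induction k) auto
  with assms show ?thesis by (simp add: has_period_def)
qed


text \<open>Unfolds \<open>jstate\<close> at literals, so that the simplifier can run the
  automaton.\<close>

lemma jstate_numeral:
  "jstate m (numeral w) = jstep m (even (pred_numeral w :: nat)) (jstate m (pred_numeral w))"
  by (simp add: numeral_eq_Suc)

section \<open>Divisibility of period lengths\<close>

lemma has_period_mult:
  assumes "has_period c p" "p dvd q" "q \<ge> 1"
  shows "has_period c q"
proof -
  from assms(2) obtain r where q: "q = r * p" by (metis dvdE mult.commute)
  have "c (k + r * p) = c k" for k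
    using assms(1) by (induction r) (auto simp: has_period_def add.assoc[symmetric] add.commute[of p])
  with assms(3) q show ?thesis by (simp add: has_period_def)
qed

text \<open>Shifting by the remainder \<open>p mod L\<close> also fixes the sequence, so minimality
  of \<open>L\<close> forces it to be 0.\<close>

lemma has_period_least_dvd:
  assumes "has_period c p"
  shows "(LEAST L. has_period c L) dvd p"
proof -
  define L where "L = (LEAST L. has_period c L)"
  have L: "has_period c L" unfolding L_def using assms by (rule LeastI)
  have "c (k + p mod L) = c k" for k
  \<comment> \<open>Length 0 is excluded by \<open>has_period\<close>, so a zero quotient is treated
    separately.\<close>
  proof (cases "p div L = 0")
    case False
    then have "has_period c (p div L * L)"
      using L by (intro has_period_mult[OF L]) (auto simp: has_period_def)
    then have "c (k + p mod L) = c (k + p mod L + p div L * L)"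
      unfolding has_period_def by metis
    also have "\<dots> = c (k + p)" by (simp add: add.assoc)
    also have "\<dots> = c k" using assms by (simp only: has_period_def)
    finally show ?thesis .
  next
    case True
    then show ?thesis using assms mod_div_mult_eq[of p L] by (simp add: has_period_def)
  qed
  then have "p mod L = 0"
    using not_less_Least[of "p mod L" "has_period c"] L
    unfolding L_def[symmetric] by (auto simp: has_period_def)
  then show ?thesis by (simp add: L_def mod_eq_0_iff_dvd)
qed

text \<open>A proper divisor of \<open>p\<close> divides \<open>p div q\<close> for some prime
  \<open>q\<close>, so only these maximal proper divisors must be refuted.\<close>

lemma smallest_period_eqI:
  assumes p: "has_period c p" and max: "\<And>q. prime q \<Longrightarrow> q dvd p \<Longrightarrow> \<not> has_period c (p div q)"
  shows "purely_periodic c \<and> smallest_period c = p"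
proof -
  define L where "L = smallest_period c"
  have L: "has_period c L" unfolding L_def smallest_period_def using p by (rule LeastI)
  have "L dvd p" unfolding L_def smallest_period_def using p by (rule has_period_least_dvd)
  then obtain r where r: "p = L * r" ..
  have "r = 1"
  proof (rule ccontr)
    assume "r \<noteq> 1"
    then obtain q where q: "prime q" "q dvd r" by (metis prime_factor_nat)
    then have "L dvd p div q" "p div q \<ge> 1"
      using r p by (auto simp: has_period_def elim!: dvdE)
    with L have "has_period c (p div q)" by (rule has_period_mult)
    with max q r show False by auto
  qed
  with p r show ?thesis unfolding purely_periodic_def L_def by auto
qed

lemma prime_dvd_24:
  assumes "prime q" "q dvd (24 :: nat)"
  shows "q = 2 \<or> q = 3"
proof -
  have "q dvd 2 ^ 3 * 3" using assms(2) by simp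
  then have "q dvd 2 \<or> q dvd 3" using assms(1) prime_dvd_mult_iff prime_dvd_power by blast
  moreover have "prime (3 :: nat)" by simp
  ultimately show ?thesis using assms(1) by (metis primes_dvd_imp_eq two_is_prime_nat)
qed

section \<open>Running the automaton for each residue of \<open>n\<close> modulo 4\<close>

lemmas jstate_eval = jstate_numeral pair_sign_def rec_sign_def even_sign_def chi4_def

theorem theorem5:
  fixes n :: nat
  assumes "n \<ge> 1"
  defines "x \<equiv> (exp (2 / real n) + 1) / (exp (2 / real n) - 1)"
  shows "purely_periodic (jacobi_seq x) \<and>
         smallest_period (jacobi_seq x) =
           (if n mod 4 = 1 \<or> n mod 4 = 3 then 24 else if n mod 4 = 2 then 8 else 2)"
proof -
  let ?c = "\<lambda>m k. jout (even k) (jstate m k)"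
  have seq: "jacobi_seq x = ?c (int n mod 4)"
    using assms cf_coth by (intro jacobi_seq_eq_jout) auto
  \<comment> \<open>In every case below, comparison with the value at index 0 suffices.\<close>
  have not_period: "\<not> has_period c q" if "c (0 + q) \<noteq> c 0" for q and c :: "nat \<Rightarrow> int option"
    using that unfolding has_period_def by blast
  have n4: "n mod 4 = nat (int n mod 4)" by (metis nat_int of_nat_numeral zmod_int)
  consider "int n mod 4 = 0" | "int n mod 4 = 1" | "int n mod 4 = 2" | "int n mod 4 = 3"
    by linarith
  then show ?thesis
  proof cases
    case 1
    have "purely_periodic (?c 0) \<and> smallest_period (?c 0) = 2"
    proof (rule smallest_period_eqI)
      show "has_period (?c 0) 2"
        by (rule jout_has_period) (simp_all add: jstate_eval)
      fix q :: nat assume "prime q" "q dvd 2"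
      then have "q = 2" by (metis primes_dvd_imp_eq two_is_prime_nat)
      \<comment> \<open>The denominator at index 1 is even, that at index 0 is 1.\<close>
      then show "\<not> has_period (?c 0) (2 div q)"
        by (intro not_period) (simp add: jstate_eval)
    qed
    then show ?thesis unfolding seq n4 1 by simp
  next
    case 2
    have "purely_periodic (?c 1) \<and> smallest_period (?c 1) = 24"
    proof (rule smallest_period_eqI)
      show "has_period (?c 1) 24"
        by (rule jout_has_period) (simp_all add: jstate_eval)
      fix q :: nat assume "prime q" "q dvd 24"
      \<comment> \<open>The candidates are 12 and 8. After 12 steps the residues recur but the sign
        is -1; at index 8 the denominator is even.\<close>
      then show "\<not> has_period (?c 1) (24 div q)"
        using prime_dvd_24[of q] by (intro not_period) (auto simp: jstate_eval)
    qed
    then show ?thesis unfolding seq n4 2 by simp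
  next
    case 3
    have "purely_periodic (?c 2) \<and> smallest_period (?c 2) = 8"
    proof (rule smallest_period_eqI)
      show "has_period (?c 2) 8"
        by (rule jout_has_period) (simp_all add: jstate_eval)
      fix q :: nat assume "prime q" "q dvd 8"
      then have "q = 2" using prime_dvd_power[of q 2 3] by (simp add: primes_dvd_imp_eq)
      \<comment> \<open>After 4 steps the residues recur, but with sign -1.\<close>
      then show "\<not> has_period (?c 2) (8 div q)"
        by (intro not_period) (simp add: jstate_eval)
    qed
    then show ?thesis unfolding seq n4 3 by simp
  next
    case 4
    have "purely_periodic (?c 3) \<and> smallest_period (?c 3) = 24"
    proof (rule smallest_period_eqI)
      show "has_period (?c 3) 24"
        by (rule jout_has_period) (simp_all add: jstate_eval)
      fix q :: nat assume "prime q" "q dvd 24"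
      then show "\<not> has_period (?c 3) (24 div q)"
        \<comment> \<open>As for residue 1: index 12 has sign -1, index 8 an even
          denominator.\<close>
        using prime_dvd_24[of q] by (intro not_period) (auto simp: jstate_eval)
    qed
    then show ?thesis unfolding seq n4 4 by simp
  qed
qed

end
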